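(* The $(5,6)$-spectrum consists of $42$ and all even integers greater than or equal to $46$, that is, it equals $\{42,46,48,50,52,\dots\}$. In particular there is no $(5,6)$-graph of order $44$, and $N(5,6)=46$.
   Context: Graphs are finite and simple. For integers $k\ge 3$, $g\ge 3$, a $(k,g)$-graph is a $k$-regular graph of girth exactly $g$. The $(k,g)$-spectrum is the set of all integers $n$ such that there exists a connected $(k,g)$-graph of order $n$. For odd $k$, $N(k,g)$ denotes the smallest element $N$ of the $(k,g)$-spectrum such that all even integers $n\ge N$ belong to the $(k,g)$-spectrum. *)

theory Defs
  imports
    "Graph_Theory.Graph_Theory"
    "HOL-Library.Extended_Nat"
begin

text \<open>
  Finite simple graphs are the locale \<^locale>\<open>pair_graph\<close>: finite, loop-free, symmetric digraphs
  whose arcs are pairs of vertices, an undirected edge being a pair of opposite arcs.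
\<close>

text \<open>
  In a symmetric digraph, \<^const>\<open>pre_digraph.cycle\<close> also admits traversing an edge back and forth
  (length 2). The cycles of the underlying undirected graph are exactly those of length at least 3.
  The girth of an acyclic graph is infinite.
\<close>

definition girth :: "'a pair_pre_digraph \<Rightarrow> enat" where
  "girth G = (INF p \<in> {p. pre_digraph.cycle (with_proj G) p \<and> 3 \<le> length p}. enat (length p))"

definition regular :: "nat \<Rightarrow> 'a pair_pre_digraph \<Rightarrow> bool" where
  "regular k G \<longleftrightarrow> (\<forall>v \<in> pverts G. out_degree (with_proj G) v = k)"

definition kg_graph :: "nat \<Rightarrow> nat \<Rightarrow> 'a pair_pre_digraph \<Rightarrow> bool" where
  "kg_graph k g G \<longleftrightarrow> pair_graph G \<and> regular k G \<and> girth G = enat g"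

text \<open>
  Up to isomorphism every finite graph has natural numbers as vertices, so the choice of vertex
  type is no restriction.
\<close>

definition kg_spectrum :: "nat \<Rightarrow> nat \<Rightarrow> nat set" where
  "kg_spectrum k g =
    {n. \<exists>G :: nat pair_pre_digraph.
          kg_graph k g G \<and> connected (with_proj G) \<and> card (pverts G) = n}"

definition kg_N :: "nat \<Rightarrow> nat \<Rightarrow> nat" where
  "kg_N k g = (LEAST N. N \<in> kg_spectrum k g \<and> (\<forall>n\<ge>N. even n \<longrightarrow> n \<in> kg_spectrum k g))"

end

theory Submission
  imports Defs "Jordan_Normal_Form.Determinant"
begin

text \<open>
  \<^bold>\<open>Which orders are excluded.\<close> Fix a vertex \<open>v\<close> of a 5-regular graph of girth 6 and let \<open>far v\<close>
  be the set of vertices at distance at least 3 from \<open>v\<close>. The 20 vertices at distance 2 send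
  80 edges into \<open>far v\<close>, so \<open>far v\<close> has at least 16 vertices and the order is at least
  \<open>1 + 5 + 20 + 16 = 42\<close> (\<open>moore_bound\<close>). Odd orders are excluded by the handshake lemma.

  \<^bold>\<open>Why 44 is excluded.\<close> Now \<open>far v\<close> has 18 vertices, and counting degrees leaves exactly five edges
  inside it. The short cycles that are forbidden make the two end points of each of these edges have
  at least 5 neighbours in \<open>far v\<close> together (\<open>far_edge_deg\<close>), and then the five edges can only
  form a star (\<open>far_star\<close>). Consequently \<open>v\<close>, its sphere of radius 2 and the centre of the star
  form one class of a bipartition into 22 + 22 vertices (\<open>bipartite\<close>).
  Every vertex \<open>p\<close> of such a bipartite graph has exactly one \<open>mate\<close>, a vertex of its own class that
  shares no neighbour with \<open>p\<close>, and taking mates preserves adjacency (\<open>mate_adj\<close>). Choose one vertex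
  from each of the eleven mate pairs in either class and record adjacency to \<open>l\<close> by \<open>1\<close> and adjacency
  to \<open>mate l\<close> by \<open>-1\<close>: the result is an integer \<open>11 \<times> 11\<close> matrix \<open>D\<close> with
  \<open>D D\<^sup>T = 5 I\<close> (\<open>sgn_inc_rows_orthogonal\<close>), so \<open>5 ^ 11\<close> would be the square of \<open>det D\<close>
  (\<open>no_weighing_matrix_11_5\<close>).

  \<^bold>\<open>Why the other even orders occur.\<close> Take two copies of the integers modulo \<open>m\<close> and join \<open>i\<close> in
  one to \<open>j\<close> in the other when \<open>i + j\<close> lies in a set \<open>S\<close> of five residues. The graph has no 4-cycle
  when sums of two elements of \<open>S\<close> determine the summands. The perfect difference
  set \<open>{0, 1, 4, 14, 16}\<close> modulo 21 gives order 42, and the Golomb ruler \<open>{0, 1, 4, 9, 11}\<close>, of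
  length 11, has this property modulo every \<open>m \<ge> 23\<close>, which gives all even orders from 46 on.
\<close>

section \<open>Involutions and integer weighing matrices\<close>

text \<open>
  An injection into the natural numbers breaks the tie in each two-element orbit: the
  smaller element is chosen.
\<close>

lemma involution_transversal:
  assumes "finite X" and "\<And>x. x \<in> X \<Longrightarrow> f x \<in> X" and "\<And>x. x \<in> X \<Longrightarrow> f (f x) = x"
    and "\<And>x. x \<in> X \<Longrightarrow> f x \<noteq> x"
  obtains T where "T \<subseteq> X" "T \<inter> f ` T = {}" "T \<union> f ` T = X" "card X = 2 * card T"
proof -
  obtain g :: "'a \<Rightarrow> nat" where g: "inj_on g X"
    using finite_imp_inj_to_nat_seg[OF assms(1)] by blast
  define T where "T = {x \<in> X. g x < g (f x)}"
  have sub: "T \<subseteq> X" by (auto simp: T_def)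
  have disj: "T \<inter> f ` T = {}"
    using assms(3) by (fastforce simp: T_def)
  have un: "T \<union> f ` T = X"
  proof
    show "T \<union> f ` T \<subseteq> X" using assms(2) by (auto simp: T_def)
    show "X \<subseteq> T \<union> f ` T"
    proof
      fix x assume x: "x \<in> X"
      then have "g x \<noteq> g (f x)" using assms(2,4) g by (metis inj_on_eq_iff)
      then consider "g x < g (f x)" | "g (f x) < g (f (f x))" using assms(3) x by force
      then show "x \<in> T \<union> f ` T"
      proof cases
        case 2
        then have "f x \<in> T" using x assms(2) by (simp add: T_def)
        then show ?thesis using assms(3)[OF x] by (metis UnI2 imageI)
      qed (use x in \<open>auto simp: T_def\<close>)
    qed
  qed
  have "inj_on f T" using assms(3) by (metis (no_types, lifting) inj_on_def subsetD sub)
  then have "card X = 2 * card T"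
    using un disj card_Un_disjoint[of T "f ` T"] finite_subset[OF sub assms(1)]
    by (simp add: card_image)
  then show ?thesis using that sub disj un by blast
qed

text \<open>
  The determinant would be an integer with square \<open>5 ^ 11\<close>. Because the exponent is odd, this
  power is congruent to 2 modulo 3, which no square is.
\<close>

lemma no_weighing_matrix_11_5:
  fixes D :: "int mat"
  assumes D: "D \<in> carrier_mat 11 11" and gram: "D * transpose_mat D = 5 \<cdot>\<^sub>m 1\<^sub>m 11"
  shows False
proof -
  from gram have "det D * det (transpose_mat D) = det (5 \<cdot>\<^sub>m 1\<^sub>m 11 :: int mat)"
    using det_mult[OF D, of "transpose_mat D"] D by simp
  then have "det D * det D = 5 ^ 11"
    using det_transpose[OF D] by simp
  then have "(det D * det D) mod 3 = 2" by simp
  moreover have "(x * x) mod 3 \<noteq> 2" for x :: int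
  proof -
    have "x mod 3 = 0 \<or> x mod 3 = 1 \<or> x mod 3 = 2" by presburger
    then show ?thesis by (auto simp: mod_mult_eq[of x 3 x, symmetric])
  qed
  ultimately show False by blast
qed

section \<open>Graphs of girth 6 seen from one vertex\<close>

text \<open>
  A finite 5-regular graph of girth at least 6. Cycles of length 3 and 5 are excluded in the form
  of closed walks, which spares distinctness conditions: a closed walk of odd length
  contains an odd cycle that is no longer. For length 4 the back-and-forth walks remain.
\<close>

locale quintic_girth6 =
  fixes V :: "'a set" and E :: "'a \<Rightarrow> 'a \<Rightarrow> bool"
  assumes finite_V: "finite V"
    and adj_V: "E a b \<Longrightarrow> a \<in> V"
    and sym: "E a b \<Longrightarrow> E b a"
    and degree: "a \<in> V \<Longrightarrow> card {b. E a b} = 5"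
    and no_walk3: "\<lbrakk>E a b; E b c; E c a\<rbrakk> \<Longrightarrow> False"
    and no_cycle4: "\<lbrakk>E a b; E b c; E c d; E d a\<rbrakk> \<Longrightarrow> a = c \<or> b = d"
    and no_walk5: "\<lbrakk>E a b; E b c; E c d; E d e; E e a\<rbrakk> \<Longrightarrow> False"
begin

definition N :: "'a \<Rightarrow> 'a set" where "N a = {b. E a b}"

lemma in_N [simp]: "b \<in> N a \<longleftrightarrow> E a b"
  by (simp add: N_def)

lemma adj_V': "E a b \<Longrightarrow> b \<in> V"
  using adj_V sym by metis

lemma N_subset: "N a \<subseteq> V"
  using adj_V' by auto

lemma finite_N [simp]: "finite (N a)"
  using N_subset finite_V finite_subset by blast

lemma card_N: "a \<in> V \<Longrightarrow> card (N a) = 5"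
  using degree by (simp add: N_def)

lemma irrefl: "\<not> E a a"
  using no_walk3[of a a a] by blast

lemma common_nbr_unique: "\<lbrakk>a \<noteq> b; E a x; E b x; E a y; E b y\<rbrakk> \<Longrightarrow> x = y"
  using no_cycle4[of a x b y] sym[of b x] sym[of a y] by simp

text \<open>
  The handshake lemma: reversal pairs up the \<open>5 * card V\<close> arcs.
\<close>

lemma even_card_V: "even (card V)"
proof -
  define X where "X = {(a, b). E a b}"
  have X: "X = Sigma V N" using adj_V by (auto simp: X_def)
  then have card: "card X = 5 * card V"
    using finite_V by (simp add: card_SigmaI card_N)
  have fin: "finite X" using X finite_V by simp
  have swap: "prod.swap x \<in> X" "prod.swap x \<noteq> x" if "x \<in> X" for x
    using that sym[of "fst x" "snd x"] irrefl[of "fst x"] unfolding X_def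
    by (auto simp: prod.swap_def)
  have "\<exists>T :: ('a \<times> 'a) set. card X = 2 * card T"
    by (rule involution_transversal[of X prod.swap, OF fin swap(1) swap_swap swap(2)]) (assumption | rule exI)+
  then have "even (5 * card V)" using card by (metis dvd_triv_left)
  then show ?thesis by simp
qed

definition sphere2 :: "'a \<Rightarrow> 'a set" where "sphere2 v = (\<Union>u \<in> N v. N u - {v})"

definition far :: "'a \<Rightarrow> 'a set" where "far v = V - insert v (N v \<union> sphere2 v)"

lemma in_sphere2: "x \<in> sphere2 v \<longleftrightarrow> x \<noteq> v \<and> (\<exists>u. E v u \<and> E u x)"
  by (auto simp: sphere2_def)

lemma sphere2_commute: "x \<in> sphere2 v \<longleftrightarrow> v \<in> sphere2 x"
  unfolding in_sphere2 using sym by metis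

lemma sphere2_subset: "sphere2 v \<subseteq> V"
  using adj_V' by (auto simp: in_sphere2)

lemma finite_sphere2 [simp]: "finite (sphere2 v)"
  using sphere2_subset finite_V finite_subset by blast

lemma finite_far [simp]: "finite (far v)"
  using finite_V by (simp add: far_def)

lemma in_far: "x \<in> far v \<longleftrightarrow> x \<in> V \<and> x \<noteq> v \<and> \<not> E v x \<and> x \<notin> sphere2 v"
  by (auto simp: far_def)

lemma card_sphere2:
  assumes "v \<in> V" shows "card (sphere2 v) = 20"
proof -
  have "card (sphere2 v) = (\<Sum>u \<in> N v. card (N u - {v}))"
    unfolding sphere2_def
  proof (rule card_UN_disjoint)
    show "\<forall>i\<in>N v. \<forall>j\<in>N v. i \<noteq> j \<longrightarrow> (N i - {v}) \<inter> (N j - {v}) = {}"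
    proof (intro ballI impI)
      fix i j assume ij: "i \<in> N v" "j \<in> N v" "i \<noteq> j"
      have False if "x \<in> N i - {v}" "x \<in> N j - {v}" for x
        using common_nbr_unique[of i j x v] ij that sym[of v i] sym[of v j] by simp
      then show "(N i - {v}) \<inter> (N j - {v}) = {}" by blast
    qed
  qed auto
  also have "\<dots> = (\<Sum>u \<in> N v. 4)"
  proof (intro sum.cong refl)
    fix u assume "u \<in> N v"
    then have "u \<in> V" "v \<in> N u" using adj_V'[of v u] sym[of v u] by simp_all
    then show "card (N u - {v}) = 4" by (simp add: card_N card_Diff_singleton)
  qed
  finally show ?thesis using card_N[OF assms] by simp
qed

lemma card_far:
  assumes "v \<in> V" shows "card (far v) + 26 = card V"
proof -
  have "x \<notin> sphere2 v" if "x \<in> N v" for x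
    using that no_walk3[of v _ x] sym[of v x] unfolding in_sphere2 by auto
  then have "N v \<inter> sphere2 v = {}" "v \<notin> N v \<union> sphere2 v"
    using irrefl by (blast, simp add: in_sphere2)
  then have "card (insert v (N v \<union> sphere2 v)) = 26"
    by (simp add: card_Un_disjoint card_N card_sphere2 assms)
  moreover have "insert v (N v \<union> sphere2 v) \<subseteq> V"
    using N_subset sphere2_subset assms by blast
  ultimately show ?thesis
    unfolding far_def using finite_V
    by (metis add.commute card_Diff_subset card_mono finite_subset le_add_diff_inverse)
qed

text \<open>
  An edge inside the sphere would close a walk of length 5 through the centre.
\<close>

lemma no_edge_sphere2: "\<lbrakk>x \<in> sphere2 v; y \<in> sphere2 v\<rbrakk> \<Longrightarrow> \<not> E x y"
proof
  assume x: "x \<in> sphere2 v" and y: "y \<in> sphere2 v" and xy: "E x y"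
  obtain u w where "E v u" "E u x" "E v w" "E w y" using x y unfolding in_sphere2 by blast
  then show False using no_walk5[of v u x y w] xy sym[of v w] sym[of w y] by blast
qed

lemma card_N_far_of_sphere2:
  assumes "x \<in> sphere2 v" shows "card (N x \<inter> far v) = 4"
proof -
  obtain u where u: "E v u" "E u x" and "x \<noteq> v" using assms by (auto simp: in_sphere2)
  have "N x \<inter> far v = N x - {u}"
  proof
    show "N x \<inter> far v \<subseteq> N x - {u}" using u by (auto simp: in_far)
    show "N x - {u} \<subseteq> N x \<inter> far v"
    proof
      fix y assume "y \<in> N x - {u}"
      then have y: "E x y" "y \<noteq> u" by auto
      have "y \<noteq> v" using no_walk3[of v u x] u y by blast
      moreover have "\<not> E v y" using common_nbr_unique[of v x u y] \<open>x \<noteq> v\<close> u y sym[of u x] by auto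
      moreover have "y \<notin> sphere2 v" using no_edge_sphere2[of x v y] assms y by blast
      ultimately show "y \<in> N x \<inter> far v" using y adj_V' by (auto simp: in_far)
    qed
  qed
  then show ?thesis using sym[OF u(2)] card_N[of x] adj_V'[OF u(2)] by (simp add: card_Diff_singleton)
qed

lemma edge_count_swap:
  assumes "finite A" "finite B"
  shows "(\<Sum>a\<in>A. card (N a \<inter> B)) = (\<Sum>b\<in>B. card (N b \<inter> A))"
proof -
  have *: "card (N a \<inter> C) = (\<Sum>c\<in>C. of_bool (E a c))" if "finite C" for a C
    using that by (simp add: Int_commute sum.inter_filter[symmetric] N_def Int_def of_bool_def)
  have "(\<Sum>a\<in>A. card (N a \<inter> B)) = (\<Sum>a\<in>A. \<Sum>b\<in>B. of_bool (E a b))"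
    using * assms by simp
  also have "\<dots> = (\<Sum>b\<in>B. \<Sum>a\<in>A. of_bool (E b a))"
    by (subst sum.swap) (auto intro!: sum.cong simp: of_bool_def intro: sym)
  finally show ?thesis using * assms by simp
qed

text \<open>
  The degree in the subgraph induced on \<open>far v\<close>.
\<close>

definition far_deg :: "'a \<Rightarrow> 'a \<Rightarrow> nat" where "far_deg v r = card (N r \<inter> far v)"

lemma far_deg_eq:
  assumes "r \<in> far v" shows "card (N r \<inter> sphere2 v) + far_deg v r = 5"
proof -
  have "N r = (N r \<inter> sphere2 v) \<union> (N r \<inter> far v)"
  proof (intro equalityI subsetI)
    fix x assume "x \<in> N r"
    then have x: "E r x" "E x r" "x \<in> V" using sym[of r x] adj_V'[of r x] by simp_all
    have "\<not> E v x" using assms x in_sphere2[of r v] by (auto simp: in_far)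
    moreover have "x \<noteq> v" using assms x by (auto simp: in_far)
    ultimately show "x \<in> (N r \<inter> sphere2 v) \<union> (N r \<inter> far v)"
      using x by (auto simp: in_far)
  qed auto
  moreover have "(N r \<inter> sphere2 v) \<inter> (N r \<inter> far v) = {}" by (auto simp: in_far)
  ultimately have "card (N r) = card (N r \<inter> sphere2 v) + card (N r \<inter> far v)"
    by (metis card_Un_disjoint finite_Int finite_N)
  then show ?thesis using assms card_N by (simp add: in_far far_deg_def)
qed

text \<open>
  Double counting of the edges between \<open>far v\<close> and the sphere of radius 2, which number
  \<open>20 * 4 = 80\<close>.
\<close>

lemma sum_far_deg:
  assumes "v \<in> V" shows "80 + (\<Sum>r \<in> far v. far_deg v r) = 5 * card (far v)"
proof -
  have "(\<Sum>r \<in> far v. card (N r \<inter> sphere2 v)) = (\<Sum>x \<in> sphere2 v. card (N x \<inter> far v))"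
    by (rule edge_count_swap) auto
  also have "\<dots> = 80" using card_sphere2[OF assms] by (simp add: card_N_far_of_sphere2)
  finally have "80 + (\<Sum>r \<in> far v. far_deg v r) = (\<Sum>r \<in> far v. card (N r \<inter> sphere2 v) + far_deg v r)"
    by (simp add: sum.distrib)
  then show ?thesis by (simp add: far_deg_eq)
qed

lemma moore_bound:
  assumes "V \<noteq> {}" shows "42 \<le> card V"
proof -
  obtain v where "v \<in> V" using assms by blast
  from card_far[OF this] sum_far_deg[OF this] show ?thesis by linarith
qed

text \<open>
  Each neighbour of \<open>r\<close> or \<open>s\<close> in the sphere of radius 2 hangs from a neighbour of \<open>v\<close>. Two of them
  hanging from the same one would close a 4-cycle, or through the edge \<open>r s\<close> a 5-cycle. So
  \<open>r\<close> and \<open>s\<close> have at most five neighbours in the sphere together, and of their ten neighbours at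
  least five are in \<open>far v\<close>.
\<close>

lemma far_edge_deg:
  assumes "r \<in> far v" "s \<in> far v" "E r s"
  shows "5 \<le> far_deg v r + far_deg v s"
proof -
  define W where "W = (N r \<union> N s) \<inter> sphere2 v"
  have "\<exists>u. E v u \<and> E u x" if "x \<in> W" for x
    using that by (auto simp: W_def in_sphere2)
  then obtain par where par: "\<And>x. x \<in> W \<Longrightarrow> E v (par x) \<and> E (par x) x"
    by metis
  have "inj_on par W"
  proof (rule inj_onI, rule ccontr)
    fix x y assume xy: "x \<in> W" "y \<in> W" and eq: "par x = par y" and "x \<noteq> y"
    let ?u = "par x"
    have u: "E ?u x" "E ?u y" using par xy eq by metis+
    have ne: "?u \<noteq> r" "?u \<noteq> s" using par[OF xy(1)] assms by (auto simp: in_far)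
    have "(E r x \<or> E s x) \<and> (E r y \<or> E s y)" using xy by (auto simp: W_def)
    moreover have "\<not> (E r x \<and> E r y)" "\<not> (E s x \<and> E s y)"
      using common_nbr_unique u ne \<open>x \<noteq> y\<close> by metis+
    moreover have "\<not> (E r x \<and> E s y)" "\<not> (E s x \<and> E r y)"
      using no_walk5[of ?u x r s y] no_walk5[of ?u x s r y] u sym[of r] sym[of s] sym[of ?u y] assms(3)
      by metis+
    ultimately show False by blast
  qed
  then have "card W \<le> card (N v)"
    by (rule card_inj_on_le) (use par in auto)
  also have "v \<in> V \<or> N v = {}" using adj_V by auto
  then have "card (N v) \<le> 5" using card_N[of v] by auto
  finally have "card W \<le> 5" .
  moreover have "W = (N r \<inter> sphere2 v) \<union> (N s \<inter> sphere2 v)" by (auto simp: W_def)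
  moreover have "(N r \<inter> sphere2 v) \<inter> (N s \<inter> sphere2 v) = {}"
    using no_walk3[OF assms(3)] sym[of r] by (simp add: disjoint_iff, blast)
  ultimately have "card (N r \<inter> sphere2 v) + card (N s \<inter> sphere2 v) \<le> 5"
    by (metis card_Un_disjoint finite_Int finite_N)
  then show ?thesis using far_deg_eq[OF assms(1)] far_deg_eq[OF assms(2)] by linarith
qed

text \<open>
  The degrees in \<open>far v\<close> sum to 10. By the previous lemma some \<open>w\<close> has degree at least 3, and
  its neighbours have degree at least \<open>5 - far_deg v w\<close>. One further edge avoiding \<open>w\<close> would
  contribute another 5 to the sum while taking away at most one of these neighbours, and push it
  beyond 10. So all edges contain \<open>w\<close>, and as there are five of them, \<open>w\<close> has all its neighbours in
  \<open>far v\<close>.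
\<close>

lemma far_star:
  assumes "v \<in> V" and "card V = 44"
  obtains w where "w \<in> far v" "N w \<subseteq> far v"
    "\<And>a b. \<lbrakk>a \<in> far v; b \<in> far v; E a b\<rbrakk> \<Longrightarrow> a = w \<or> b = w"
proof -
  let ?d = "far_deg v"
  have sum10: "(\<Sum>r \<in> far v. ?d r) = 10"
    using sum_far_deg card_far assms by fastforce
  then obtain r where "r \<in> far v" "?d r \<noteq> 0"
    by (metis sum.neutral zero_neq_numeral)
  then obtain s where "s \<in> far v" "E r s"
    unfolding far_deg_def by (metis IntE card.empty equals0I in_N)
  then have "3 \<le> ?d r \<or> 3 \<le> ?d s"
    using far_edge_deg[of r v s] \<open>r \<in> far v\<close> by linarith
  then obtain w where w: "w \<in> far v" "3 \<le> ?d w"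
    using \<open>r \<in> far v\<close> \<open>s \<in> far v\<close> by blast
  define T where "T = N w \<inter> far v"
  have T: "finite T" "T \<subseteq> far v" "w \<notin> T" "card T = ?d w"
    using irrefl by (auto simp: T_def far_deg_def)
  have dT: "1 \<le> ?d t" "5 \<le> ?d w + ?d t" if "t \<in> T" for t
  proof -
    have "w \<in> N t \<inter> far v" using that w sym[of w t] by (simp add: T_def)
    then show "1 \<le> ?d t" unfolding far_deg_def
      by (metis One_nat_def Suc_leI card_gt_0_iff empty_iff finite_Int finite_N)
    show "5 \<le> ?d w + ?d t" using that w far_edge_deg by (simp add: T_def)
  qed
  have "?d w \<le> 5" using far_deg_eq[OF w(1)] by linarith
  have star: "a = w \<or> b = w" if ab: "a \<in> far v" "b \<in> far v" "E a b" for a b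
  proof (rule ccontr)
    assume "\<not> (a = w \<or> b = w)"
    then have ne: "a \<noteq> w" "b \<noteq> w" by auto
    have "a \<noteq> b" using ab irrefl by blast
    \<comment> \<open>Otherwise \<open>w\<close>, \<open>a\<close>, \<open>b\<close> would be a triangle.\<close>
    have "a \<notin> T \<or> b \<notin> T"
      using no_walk3[of w a b] ab sym[of w b] by (auto simp: T_def)
    then have "T - {a, b} = T - {a} \<or> T - {a, b} = T - {b}" by blast
    then have cT: "?d w - 1 \<le> card (T - {a, b})"
      using T by (metis diff_card_le_card_Diff finite.emptyI finite.insertI card.empty card_insert_if empty_iff One_nat_def)
    let ?R = "T - {a, b}"
    have "?d w + ((\<Sum>t \<in> ?R. ?d t) + (?d a + ?d b)) = sum ?d (insert w (?R \<union> {a, b}))"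
      using T ne \<open>a \<noteq> b\<close> by (simp add: sum.union_disjoint)
    also have "\<dots> \<le> sum ?d (far v)"
      using T w ab by (intro sum_mono2) auto
    finally have le: "?d w + ((\<Sum>t \<in> ?R. ?d t) + (?d a + ?d b)) \<le> 10" using sum10 by simp
    have "card ?R \<le> (\<Sum>t \<in> ?R. ?d t)" "card ?R * (5 - ?d w) \<le> (\<Sum>t \<in> ?R. ?d t)"
      using sum_bounded_below[of ?R 1 ?d] sum_bounded_below[of ?R "5 - ?d w" ?d] dT
      by (force simp: le_diff_conv)+
    moreover have "?d w = 3 \<or> ?d w = 4 \<or> ?d w = 5" using w \<open>?d w \<le> 5\<close> by linarith
    moreover have "5 \<le> ?d a + ?d b" using far_edge_deg ab by blast
    \<comment> \<open>For \<open>far_deg v w = 3, 4, 5\<close> the sum is at least \<open>3 + 4 + 5\<close>, \<open>4 + 3 + 5\<close>, \<open>5 + 4 + 5\<close>.\<close>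
    ultimately show False using le cT by fastforce
  qed
  have "?d w = 5"
  proof -
    have d01: "?d r = of_bool (r \<in> T)" if "r \<in> far v - {w}" for r
    proof -
      have sub: "N r \<inter> far v \<subseteq> {w}" using star[of r] that by fastforce
      show ?thesis
      proof (cases "r \<in> T")
        case True
        then have "w \<in> N r \<inter> far v" using w sym[of w r] by (simp add: T_def)
        then have "N r \<inter> far v = {w}" using sub by blast
        then show ?thesis using True by (simp add: far_deg_def)
      next
        case False
        then have "w \<notin> N r" using that sym[of r w] by (auto simp: T_def)
        then have "N r \<inter> far v = {}" using sub by blast
        then show ?thesis using False by (simp add: far_deg_def)
      qed
    qed
    have "10 = ?d w + (\<Sum>r \<in> far v - {w}. ?d r)"
      using sum10 w by (simp add: sum.remove)
    also have "(\<Sum>r \<in> far v - {w}. ?d r) = (\<Sum>r \<in> far v - {w}. of_bool (r \<in> T))"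
      using d01 by (rule sum.cong[OF refl])
    also have "\<dots> = card ((far v - {w}) \<inter> T)" by (simp add: Int_def)
    also have "(far v - {w}) \<inter> T = T" using T by blast
    finally show ?thesis using T by simp
  qed
  then have "T = N w"
    using card_N[of w] w by (simp add: T_def far_deg_def card_subset_eq in_far)
  then have "N w \<subseteq> far v" using T by simp
  then show ?thesis using that w star by blast
qed

text \<open>
  With \<open>w\<close> the centre of the star, \<open>{v, w}\<close> and the sphere of radius 2 form one class. The other class
  consists of the neighbours of \<open>v\<close> and of \<open>far v - {w}\<close>: the latter is independent because every
  edge inside \<open>far v\<close> contains \<open>w\<close>, and \<open>w\<close> is not adjacent to the sphere because all its neighbours
  lie in \<open>far v\<close>.
\<close>

lemma bipartite:
  assumes "V \<noteq> {}" and "card V = 44"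
  obtains S where "S \<subseteq> V" "card S = 22" "\<And>a b. E a b \<Longrightarrow> a \<in> S \<longleftrightarrow> b \<notin> S"
proof -
  obtain v where v: "v \<in> V" using assms by blast
  obtain w where w: "w \<in> far v" "N w \<subseteq> far v"
    "\<And>a b. \<lbrakk>a \<in> far v; b \<in> far v; E a b\<rbrakk> \<Longrightarrow> a = w \<or> b = w"
    by (rule far_star[OF v assms(2)]) (rule that)
  define S where "S = insert v (insert w (sphere2 v))"
  have "v \<notin> sphere2 v" "w \<notin> sphere2 v" "v \<noteq> w" using w(1) by (auto simp: in_sphere2 in_far)
  then have "card S = 22" by (simp add: S_def card_sphere2 v)
  have "S \<subseteq> V" using v w(1) sphere2_subset[of v] by (auto simp: S_def in_far)
  moreover note \<open>card S = 22\<close>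
  moreover have "a \<in> S \<longleftrightarrow> b \<notin> S" if ab: "E a b" for a b
  proof -
    have inS: "x \<in> S \<longleftrightarrow> \<not> E v x \<and> (x \<in> far v \<longrightarrow> x = w)" if "x \<in> V" for x
    proof -
      have "\<not> E v x" if "x \<in> sphere2 v" for x
        using that no_walk3[of v _ x] sym[of v x] by (auto simp: in_sphere2)
      then show ?thesis using \<open>x \<in> V\<close> w(1) irrefl[of v] unfolding S_def in_far insert_iff by metis
    qed
    have one: "y \<notin> S" if xy: "x \<in> S" "E x y" for x y
    proof -
      have y: "y \<in> V" "E y x" using that adj_V'[of x y] sym[of x y] by auto
      consider "x = v" | "x = w" | "x \<in> sphere2 v" using xy(1) by (auto simp: S_def)
      then show ?thesis
      proof cases
        case 1 then show ?thesis using inS[of y] y that by simp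
      next
        case 2
        then have "y \<in> far v" "y \<noteq> w" using w(2) that irrefl[of w] by auto
        then show ?thesis using inS[of y] y by simp
      next
        case 3
        have "y \<noteq> w" using w(2) y(2) 3 in_far[of x v] by auto
        moreover have "y \<notin> sphere2 v" using no_edge_sphere2[of x v y] 3 that by blast
        moreover have "y \<in> far v \<or> E v y \<or> y = v \<or> y \<in> sphere2 v" using y by (auto simp: in_far)
        moreover have "y \<noteq> v" using inS[of x] that y adj_V[of x y] by auto
        ultimately show ?thesis using inS[of y] y(1) by blast
      qed
    qed
    have "b \<in> S" if "a \<notin> S"
    proof (rule ccontr)
      assume "b \<notin> S"
      have V: "a \<in> V" "b \<in> V" using ab adj_V adj_V' by auto
      then have "E v a \<or> a \<in> far v \<and> a \<noteq> w" "E v b \<or> b \<in> far v \<and> b \<noteq> w"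
        using inS[of a] inS[of b] that \<open>b \<notin> S\<close> by blast+
      moreover have "\<not> (E v a \<and> E v b)" using no_walk3[of v a b] ab sym[of v b] by blast
      moreover have "\<not> (E v a \<and> b \<in> far v)" using ab by (auto simp: in_far in_sphere2)
      moreover have "\<not> (E v b \<and> a \<in> far v)" using sym[OF ab] by (auto simp: in_far in_sphere2)
      ultimately show False using w(3) ab by blast
    qed
    then show ?thesis using one[of a b] ab by blast
  qed
  ultimately show ?thesis by (rule that)
qed

end

section \<open>Excess two: mates and a signed incidence matrix\<close>

locale excess_two_bipartite = quintic_girth6 +
  fixes S :: "'a set"
  assumes S_subset: "S \<subseteq> V" and card_S: "card S = 22" and card_V: "card V = 44"
    and bip: "E a b \<Longrightarrow> a \<in> S \<longleftrightarrow> b \<notin> S"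
begin

lemma card_compl: "card (V - S) = 22"
  using S_subset card_S card_V finite_subset[OF S_subset finite_V] by (simp add: card_Diff_subset)

definition mate :: "'a \<Rightarrow> 'a" where
  "mate v = (THE w. w \<in> V \<and> (w \<in> S \<longleftrightarrow> v \<in> S) \<and> w \<noteq> v \<and> w \<notin> sphere2 v)"

text \<open>
  In its class of 22 vertices, a vertex sees itself and the 20 vertices at distance 2,
  and so misses exactly one.
\<close>

lemma ex1_mate:
  assumes "v \<in> V"
  shows "\<exists>!w. w \<in> V \<and> (w \<in> S \<longleftrightarrow> v \<in> S) \<and> w \<noteq> v \<and> w \<notin> sphere2 v"
proof -
  define side where "side = {w \<in> V. w \<in> S \<longleftrightarrow> v \<in> S}"
  have "side = (if v \<in> S then S else V - S)" using S_subset by (auto simp: side_def)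
  then have side: "card side = 22" using card_S card_compl by simp
  have "finite side" using finite_V by (simp add: side_def)
  have "sphere2 v \<subseteq> side"
  proof
    fix x assume "x \<in> sphere2 v"
    then obtain u where u: "E v u" "E u x" by (auto simp: in_sphere2)
    then show "x \<in> side" using bip[OF u(1)] bip[OF u(2)] adj_V'[OF u(2)] by (simp add: side_def)
  qed
  then have "insert v (sphere2 v) \<subseteq> side" using assms by (simp add: side_def)
  moreover have "card (insert v (sphere2 v)) = 21" using assms by (simp add: card_sphere2 in_sphere2)
  ultimately have "card (side - insert v (sphere2 v)) = 1"
    using side \<open>finite side\<close> by (simp add: card_Diff_subset)
  then obtain w where w: "side - insert v (sphere2 v) = {w}" by (auto simp: card_1_singleton_iff)
  have "x \<in> V \<and> (x \<in> S \<longleftrightarrow> v \<in> S) \<and> x \<noteq> v \<and> x \<notin> sphere2 v \<longleftrightarrow> x \<in> side - insert v (sphere2 v)" for x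
    by (simp add: side_def)
  then show ?thesis unfolding w by simp
qed

lemma mateD:
  assumes "v \<in> V"
  shows "mate v \<in> V" "mate v \<in> S \<longleftrightarrow> v \<in> S" "mate v \<noteq> v" "mate v \<notin> sphere2 v"
  using theI'[OF ex1_mate[OF assms]] unfolding mate_def[symmetric] by blast+

lemma mate_unique:
  "\<lbrakk>v \<in> V; w \<in> V; w \<in> S \<longleftrightarrow> v \<in> S; w \<noteq> v; w \<notin> sphere2 v\<rbrakk> \<Longrightarrow> w = mate v"
  using the1_equality[OF ex1_mate, of v w] unfolding mate_def[symmetric] by simp

lemma mate_mate: "v \<in> V \<Longrightarrow> mate (mate v) = v"
  using mate_unique[of "mate v" v] mateD[of v] sphere2_commute[of v "mate v"] by metis

lemma card_common_nbrs:
  assumes uv: "u \<in> V" "v \<in> V" "u \<in> S \<longleftrightarrow> v \<in> S" "u \<noteq> v" "u \<noteq> mate v"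
  shows "card (N u \<inter> N v) = 1"
proof -
  have "u \<in> sphere2 v" using mate_unique[of v u] uv by blast
  then obtain x where x: "E v x" "E x u" by (auto simp: in_sphere2)
  have "E u x" using x(2) by (rule sym)
  with x(1) have "y = x" if "y \<in> N u \<inter> N v" for y
    using common_nbr_unique[OF \<open>u \<noteq> v\<close>, of y x] that \<open>E u x\<close> by simp
  then have "N u \<inter> N v = {x}" using x(1) \<open>E u x\<close> unfolding N_def by blast
  then show ?thesis by simp
qed

lemma no_common_nbr_mate:
  assumes "v \<in> V" shows "N v \<inter> N (mate v) = {}"
proof -
  have False if x: "E v x" "E (mate v) x" for x
    using mateD(3,4)[OF assms] x sym[of "mate v" x] by (auto simp: in_sphere2)
  then show ?thesis by auto
qed

text \<open>
  The four neighbours of \<open>l\<close> other than \<open>p\<close> are joined to \<open>mate p\<close> by four different common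
  neighbours; the fifth neighbour of \<open>mate p\<close> shares no neighbour with \<open>l\<close>, so it must be \<open>mate l\<close>.
\<close>

lemma mate_adj:
  assumes pl: "E p l" shows "E (mate p) (mate l)"
proof -
  let ?q = "mate p"
  have V: "p \<in> V" "l \<in> V" "?q \<in> V" using adj_V[OF pl] adj_V'[OF pl] mateD(1)[of p] by blast+
  have "\<not> E ?q l" using no_common_nbr_mate[OF V(1)] pl by auto
  define f where "f r = (THE m. m \<in> N ?q \<inter> N r)" for r
  have f: "f r \<in> N ?q \<inter> N r" if "r \<in> N l - {p}" for r
  proof -
    have r: "r \<in> V" "r \<noteq> p" "E l r" using that adj_V' by auto
    have "r \<noteq> ?q" using \<open>\<not> E ?q l\<close> sym[OF r(3)] by blast
    moreover have "r \<in> S \<longleftrightarrow> ?q \<in> S"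
      using bip[OF r(3)] bip[OF pl] mateD(2)[OF V(1)] by blast
    moreover have "?q \<noteq> mate r" using mate_mate r V(1) by metis
    ultimately have "card (N ?q \<inter> N r) = 1" using card_common_nbrs[of ?q r] r V by auto
    then obtain m where "N ?q \<inter> N r = {m}" by (auto simp: card_1_singleton_iff)
    then show ?thesis by (simp add: f_def)
  qed
  have "inj_on f (N l - {p})"
  proof (rule inj_onI)
    fix r s assume rs: "r \<in> N l - {p}" "s \<in> N l - {p}" "f r = f s"
    have "f r \<noteq> l" using f[OF rs(1)] \<open>\<not> E ?q l\<close> by auto
    then show "r = s"
      using common_nbr_unique[of "f r" l r s] f[OF rs(1)] f[OF rs(2)] rs
        sym[of r "f r"] sym[of s "f s"] by simp
  qed
  then have "card (f ` (N l - {p})) = 4"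
    using V(2) sym[OF pl] by (simp add: card_image card_N card_Diff_singleton)
  moreover have "f ` (N l - {p}) \<subseteq> N ?q" using f by blast
  ultimately have "card (N ?q - f ` (N l - {p})) = 1"
    using card_N[OF V(3)] by (simp add: card_Diff_subset)
  then obtain m where m: "N ?q - f ` (N l - {p}) = {m}"
    by (auto simp: card_1_singleton_iff)
  have "E ?q m" using m by auto
  have "m = mate l"
  proof (rule mate_unique)
    show "l \<in> V" "m \<in> V" using V adj_V' \<open>E ?q m\<close> by auto
    show "m \<in> S \<longleftrightarrow> l \<in> S" using bip[OF pl] bip[OF \<open>E ?q m\<close>] mateD(2)[OF V(1)] by blast
    show "m \<noteq> l" using \<open>\<not> E ?q l\<close> \<open>E ?q m\<close> by blast
    show "m \<notin> sphere2 l"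
    proof
      assume "m \<in> sphere2 l"
      then obtain r where r: "E l r" "E r m" by (auto simp: in_sphere2)
      have "r \<noteq> p" using no_common_nbr_mate[OF V(1)] r(2) \<open>E ?q m\<close> by auto
      then have r': "r \<in> N l - {p}" using r by simp
      have "f r \<in> N ?q" "f r \<in> N r" using f[OF r'] by auto
      moreover have "r \<noteq> ?q" using \<open>\<not> E ?q l\<close> sym[OF r(1)] by blast
      ultimately have "f r = m"
        using common_nbr_unique[of r ?q "f r" m] r \<open>E ?q m\<close> by simp
      then show False using m r' by blast
    qed
  qed
  then show ?thesis using \<open>E ?q m\<close> by simp
qed

lemma mate_adj_iff:
  assumes "q \<in> V" "l \<in> V" shows "E q (mate l) \<longleftrightarrow> E (mate q) l"
  using mate_adj[of q "mate l"] mate_adj[of "mate q" l] mate_mate assms by auto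

lemma mate_transversal:
  assumes X: "X = S \<or> X = V - S"
  shows "\<exists>T \<subseteq> X. T \<inter> mate ` T = {} \<and> T \<union> mate ` T = X \<and> card T = 11"
proof -
  have "X \<subseteq> V" using X S_subset by blast
  then have "finite X" using finite_V finite_subset by blast
  moreover have "mate x \<in> X" "mate (mate x) = x" "mate x \<noteq> x" if "x \<in> X" for x
    using mateD[of x] mate_mate[of x] that X S_subset by auto
  ultimately obtain T where "T \<subseteq> X" "T \<inter> mate ` T = {}" "T \<union> mate ` T = X" "card X = 2 * card T"
    by (rule involution_transversal[of X mate]) blast+
  moreover have "card X = 22" using X card_S card_compl by auto
  ultimately show ?thesis by (intro exI[of _ T]) simp
qed

text \<open>
  The incidence matrix of the graph modulo mates, signed by whether \<open>p\<close> is joined to \<open>l\<close> or to its mate.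
\<close>

definition sgn_inc :: "'a \<Rightarrow> 'a \<Rightarrow> int" where
  "sgn_inc p l = of_bool (E p l) - of_bool (E p (mate l))"

text \<open>
  Summing over one vertex of each mate pair in the other class turns the inner product of two
  rows into \<open>\<bar>N p \<inter> N q\<bar> - \<bar>N p \<inter> N (mate q)\<bar>\<close>. For \<open>p = q\<close> this is \<open>5 - 0\<close>; otherwise both \<open>q\<close> and
  \<open>mate q\<close> share exactly one neighbour with \<open>p\<close>.
\<close>

lemma sgn_inc_rows_orthogonal:
  assumes A: "A \<subseteq> S" "A \<inter> mate ` A = {}"
    and B: "B \<subseteq> V - S" "B \<inter> mate ` B = {}" "B \<union> mate ` B = V - S"
    and pq: "p \<in> A" "q \<in> A"
  shows "(\<Sum>l \<in> B. sgn_inc p l * sgn_inc q l) = (if p = q then 5 else 0)"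
proof -
  have fin: "finite B" using B(1) finite_V finite_subset by blast
  have V: "p \<in> V" "q \<in> V" "p \<in> S" "q \<in> S" using pq A(1) S_subset by auto
  have BV: "l \<in> V" if "l \<in> B" for l using that B(1) by blast
  have inj: "inj_on mate B" by (rule inj_on_inverseI[where g = mate]) (use mate_mate BV in blast)
  have "(\<Sum>l \<in> B. sgn_inc p l * sgn_inc q l)
      = (\<Sum>l \<in> B. of_bool (E p l) * sgn_inc q l + of_bool (E p (mate l)) * sgn_inc q (mate l))"
    by (intro sum.cong refl) (auto simp: sgn_inc_def mate_mate BV algebra_simps)
  also have "\<dots> = (\<Sum>l \<in> B. of_bool (E p l) * sgn_inc q l) + (\<Sum>l \<in> mate ` B. of_bool (E p l) * sgn_inc q l)"
    by (simp add: sum.distrib sum.reindex[OF inj])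
  also have "\<dots> = (\<Sum>l \<in> V - S. of_bool (E p l) * sgn_inc q l)"
    using sum.union_disjoint[OF fin finite_imageI[OF fin] B(2)] unfolding B(3) by (rule HOL.sym)
  also have "\<dots> = (\<Sum>l \<in> N p. sgn_inc q l)"
  proof (rule sum.mono_neutral_cong_right)
    show "N p \<subseteq> V - S"
    proof
      fix l assume "l \<in> N p"
      then show "l \<in> V - S" using bip[of p l] adj_V'[of p l] V(3) by simp
    qed
  qed (simp_all add: finite_V)
  also have "\<dots> = (\<Sum>l \<in> N p. of_bool (E q l)) - (\<Sum>l \<in> N p. of_bool (E (mate q) l))"
  proof -
    have "l \<in> N p \<Longrightarrow> sgn_inc q l = of_bool (E q l) - of_bool (E (mate q) l)" for l
      using mate_adj_iff[of q l] V adj_V'[of p l] by (simp add: sgn_inc_def)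
    then show ?thesis by (simp add: sum_subtractf)
  qed
  also have "\<dots> = int (card (N p \<inter> N q)) - int (card (N p \<inter> N (mate q)))"
    by (simp add: N_def[of q] N_def[of "mate q"])
  also have "\<dots> = (if p = q then 5 else 0)"
  proof (cases "p = q")
    case True
    then show ?thesis using no_common_nbr_mate V card_N by simp
  next
    case False
    have "p \<noteq> mate q" "q \<noteq> mate p" using A pq by blast+
    then have "card (N p \<inter> N q) = 1" "card (N p \<inter> N (mate q)) = 1"
      using card_common_nbrs[of p q] card_common_nbrs[of p "mate q"] mateD[of q] mate_mate[of q] V False by auto
    then show ?thesis using False by simp
  qed
  finally show ?thesis .
qed

lemma excess_two_impossible: False
proof -
  obtain A where A: "A \<subseteq> S" "A \<inter> mate ` A = {}" "card A = 11"
    using mate_transversal[of S] by auto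
  obtain B where B: "B \<subseteq> V - S" "B \<inter> mate ` B = {}" "B \<union> mate ` B = V - S" "card B = 11"
    using mate_transversal[of "V - S"] by auto
  have fin: "finite A" "finite B" using A B card.infinite by fastforce+
  \<comment> \<open>Numbering the representatives turns the signed incidences into a matrix.\<close>
  obtain h where h: "bij_betw h {0..<11::nat} A"
    using ex_bij_betw_nat_finite[OF fin(1)] A by auto
  obtain k where k: "bij_betw k {0..<11::nat} B"
    using ex_bij_betw_nat_finite[OF fin(2)] B by auto
  define D :: "int mat" where "D = mat 11 11 (\<lambda>(i, j). sgn_inc (h i) (k j))"
  have D: "D \<in> carrier_mat 11 11" by (simp add: D_def)
  have "D * transpose_mat D = 5 \<cdot>\<^sub>m 1\<^sub>m 11"
  proof (rule eq_matI)
    fix i j assume ij: "i < dim_row (5 \<cdot>\<^sub>m 1\<^sub>m 11 :: int mat)" "j < dim_col (5 \<cdot>\<^sub>m 1\<^sub>m 11 :: int mat)"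
    then have ij': "i < 11" "j < 11" by auto
    have "(D * transpose_mat D) $$ (i, j) = (\<Sum>x = 0..<11. sgn_inc (h i) (k x) * sgn_inc (h j) (k x))"
      using ij' by (simp add: D_def scalar_prod_def)
    also have "\<dots> = (\<Sum>l \<in> B. sgn_inc (h i) l * sgn_inc (h j) l)"
      using sum.reindex_bij_betw[OF k, of "\<lambda>l. sgn_inc (h i) l * sgn_inc (h j) l"] by simp
    also have "\<dots> = (if h i = h j then 5 else 0)"
      using sgn_inc_rows_orthogonal[OF A(1,2) B(1,2,3)] h ij' by (auto simp: bij_betw_def)
    also have "h i = h j \<longleftrightarrow> i = j"
      using h ij' by (auto simp: bij_betw_def inj_on_def)
    finally show "(D * transpose_mat D) $$ (i, j) = (5 \<cdot>\<^sub>m 1\<^sub>m 11) $$ (i, j)"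
      using ij' by simp
  qed (simp_all add: D_def)
  then show False using no_weighing_matrix_11_5[OF D] by blast
qed

end

theorem (in quintic_girth6) card_V_neq_44: "card V \<noteq> 44"
proof
  assume V: "card V = 44"
  then have ne: "V \<noteq> {}" by auto
  obtain S where S: "S \<subseteq> V" "card S = 22" "\<And>a b. E a b \<Longrightarrow> a \<in> S \<longleftrightarrow> b \<notin> S"
    by (rule bipartite[OF ne V]) (rule that)
  interpret excess_two_bipartite V E S
    by unfold_locales (fact S(1), fact S(2), fact V, rule S(3))
  show False by (rule excess_two_impossible)
qed

section \<open>Cycles in pair graphs\<close>

lemma out_degree_with_proj:
  "out_degree (with_proj G) v = card {b. (v, b) \<in> parcs G}"
proof -
  have "out_arcs (with_proj G) v = Pair v ` {b. (v, b) \<in> parcs G}"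
    by (auto simp: out_arcs_def)
  then show ?thesis by (simp add: out_degree_def card_image inj_on_def)
qed

lemma girth_le:
  assumes "pre_digraph.cycle (with_proj G) p" "3 \<le> length p"
  shows "girth G \<le> enat (length p)"
  unfolding girth_def using assms by (intro INF_lower) simp

lemma cycle_with_proj:
  "pre_digraph.cycle (with_proj G) p \<longleftrightarrow>
    (\<exists>u \<in> pverts G. set p \<subseteq> parcs G \<and> pcas u p u \<and> distinct (tl (pawalk_verts u p)) \<and> p \<noteq> [])"
  by (auto simp: pre_digraph.cycle_def pre_digraph.awalk_def cas_with_proj_eq awalk_verts_with_proj_eq)

lemma kg_graph_imp_quintic_girth6:
  assumes "kg_graph 5 6 G"
  shows "quintic_girth6 (pverts G) (\<lambda>a b. (a, b) \<in> parcs G)" (is "quintic_girth6 ?V ?E")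
proof -
  interpret pair_graph G using assms by (simp add: kg_graph_def)
  have vert: "a \<in> ?V" if "?E a b" for a b using in_arcsD1 that by simp
  have irr: "a \<noteq> b" if "?E a b" for a b using pair_no_loops[OF that] by simp
  have long: "6 \<le> length p" if "pre_digraph.cycle (with_proj G) p" "3 \<le> length p" for p
    using girth_le[OF that] assms by (simp add: kg_graph_def)
  have no3: False if e: "?E a b" "?E b c" "?E c a" for a b c
  proof -
    have "pre_digraph.cycle (with_proj G) [(a, b), (b, c), (c, a)]"
      using e vert[OF e(1)] irr[OF e(1)] irr[OF e(2)] irr[OF e(3)] by (simp add: cycle_with_proj)
    then show False using long by fastforce
  qed
  have no4: "a = c \<or> b = d" if e: "?E a b" "?E b c" "?E c d" "?E d a" for a b c d
  proof (rule ccontr)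
    assume "\<not> (a = c \<or> b = d)"
    then have "pre_digraph.cycle (with_proj G) [(a, b), (b, c), (c, d), (d, a)]"
      using e vert[OF e(1)] irr[OF e(1)] irr[OF e(2)] irr[OF e(3)] irr[OF e(4)]
      by (auto simp: cycle_with_proj)
    then show False using long by fastforce
  qed
  have no5: False if e: "?E a b" "?E b c" "?E c d" "?E d x" "?E x a" for a b c d x
  proof -
    \<comment> \<open>A repeated vertex cuts a closed walk of length 5 into a triangle and a back-and-forth.\<close>
    have "a \<noteq> c" "b \<noteq> d" "c \<noteq> x" "d \<noteq> a" "x \<noteq> b"
      using e no3[of c d x] no3[of d x a] no3[of x a b] no3[of a b c] no3[of b c d] by auto
    then have "pre_digraph.cycle (with_proj G) [(a, b), (b, c), (c, d), (d, x), (x, a)]"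
      using e vert[OF e(1)] irr[OF e(1)] irr[OF e(2)] irr[OF e(3)] irr[OF e(4)] irr[OF e(5)]
      by (simp add: cycle_with_proj)
    then show False using long by fastforce
  qed
  show ?thesis
  proof
    show "finite ?V" by (rule pair_finite_verts)
    show "card {b. ?E a b} = 5" if "a \<in> ?V" for a
      using assms that by (simp add: kg_graph_def regular_def out_degree_with_proj)
  qed (use vert arcs_symmetric no3 no4 no5 in blast)+
qed

lemma spectrum_even_ge_42:
  assumes "n \<in> kg_spectrum 5 6" shows "even n" "42 \<le> n"
proof -
  obtain G :: "nat pair_pre_digraph"
    where G: "kg_graph 5 6 G" "connected (with_proj G)" "card (pverts G) = n"
    using assms by (auto simp: kg_spectrum_def)
  interpret quintic_girth6 "pverts G" "\<lambda>a b. (a, b) \<in> parcs G"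
    using G(1) by (rule kg_graph_imp_quintic_girth6)
  have "pverts G \<noteq> {}" using G(2) by (auto simp: connected_conv)
  then show "even n" "42 \<le> n" using even_card_V moore_bound G(3) by auto
qed

lemma no_order_44:
  assumes "kg_graph 5 6 G" shows "card (pverts G) \<noteq> 44"
proof -
  interpret quintic_girth6 "pverts G" "\<lambda>a b. (a, b) \<in> parcs G"
    using assms by (rule kg_graph_imp_quintic_girth6)
  show ?thesis by (rule card_V_neq_44)
qed

section \<open>Constructions from modular Sidon sets\<close>

text \<open>
  The two classes are \<open>{..<m}\<close> and \<open>{m..<2 * m}\<close>, the second being a shifted copy of the residues
  modulo \<open>m\<close>; the shift does not affect sums modulo \<open>m\<close>. Joining by sums rather than differences makes
  the relation symmetric as it stands.
\<close>

definition sum_graph :: "nat \<Rightarrow> nat set \<Rightarrow> nat pair_pre_digraph" where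
  "sum_graph m S = \<lparr>pverts = {..<2 * m},
    parcs = {(a, b). a < 2 * m \<and> b < 2 * m \<and> (a < m \<longleftrightarrow> m \<le> b) \<and> (a + b) mod m \<in> S}\<rparr>"

lemma cong_add_imp_eq:
  fixes a b b' c m :: nat
  assumes "(a + b) mod m = (a + b') mod m" "b \<in> {c..<c + m}" "b' \<in> {c..<c + m}"
  shows "b = b'"
  using assms
proof (induction b b' rule: linorder_wlog)
  case (le b b')
  have "m dvd (a + b') - (a + b)"
    using le by (metis mod_eq_dvd_iff_nat add_le_cancel_left)
  then have "m dvd b' - b" by simp
  moreover have "b' - b < m" using le by auto
  ultimately show ?case using le(1) by (metis diff_is_0_eq dvd_imp_le le_antisym linorder_not_less zero_less_diff)
next
  case (sym b b') then show ?case by metis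
qed

text \<open>
  The residues 0, 1, 4 are prescribed because they make an explicit 6-cycle and, through 0 and 1 alone, a
  Hamiltonian cycle available for all \<open>m\<close> at once.
\<close>

locale sum_graph_sidon =
  fixes m :: nat and S :: "nat set"
  assumes m: "5 \<le> m" and S: "S \<subseteq> {..<m}" "card S = 5" "{0, 1, 4} \<subseteq> S"
    and sidon: "\<And>p q r t. \<lbrakk>p \<in> S; q \<in> S; r \<in> S; t \<in> S; (p + r) mod m = (q + t) mod m\<rbrakk>
      \<Longrightarrow> p = q \<or> p = t"
begin

abbreviation "G \<equiv> sum_graph m S"

abbreviation E where "E a b \<equiv> (a, b) \<in> parcs G"

lemma adj: "E a b \<longleftrightarrow> a < 2 * m \<and> b < 2 * m \<and> (a < m \<longleftrightarrow> m \<le> b) \<and> (a + b) mod m \<in> S"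
  by (simp add: sum_graph_def)

lemma verts: "pverts G = {..<2 * m}"
  by (simp add: sum_graph_def)

lemma pair_graph: "pair_graph G"
proof
  have "parcs G \<subseteq> pverts G \<times> pverts G" by (auto simp: adj verts)
  then show "finite (parcs G)" by (rule finite_subset) (simp add: verts)
  show "symmetric (with_proj G)"
    by (auto simp: symmetric_def sym_def adj add.commute)
next
  fix e assume "e \<in> parcs G"
  then show "fst e \<in> pverts G" "snd e \<in> pverts G" "fst e \<noteq> snd e"
    using adj[of "fst e" "snd e"] by (auto simp: verts)
qed (simp add: verts)

lemma degree:
  assumes "a \<in> pverts G" shows "card {b. E a b} = 5"
proof -
  define c where "c = (if a < m then m else 0)"
  let ?I = "{c..<c + m}" and ?f = "\<lambda>b. (a + b) mod m"
  have "inj_on ?f ?I" by (rule inj_onI) (rule cong_add_imp_eq)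
  moreover have "?f ` ?I \<subseteq> {..<m}" using m by auto
  ultimately have im: "?f ` ?I = {..<m}"
    by (intro card_subset_eq) (simp_all add: card_image)
  have nbrs: "{b. E a b} = {b \<in> ?I. ?f b \<in> S}"
    using assms by (auto simp: adj verts c_def)
  have "?f ` {b \<in> ?I. ?f b \<in> S} = S"
  proof
    show "S \<subseteq> ?f ` {b \<in> ?I. ?f b \<in> S}"
    proof
      fix s assume "s \<in> S"
      then have "s \<in> ?f ` ?I" using im S(1) by blast
      then show "s \<in> ?f ` {b \<in> ?I. ?f b \<in> S}" using \<open>s \<in> S\<close> by auto
    qed
  qed auto
  moreover have "inj_on ?f {b \<in> ?I. ?f b \<in> S}"
    using \<open>inj_on ?f ?I\<close> by (rule inj_on_subset) blast
  ultimately show ?thesis using nbrs S(2) card_image[of ?f "{b \<in> ?I. ?f b \<in> S}"] by simp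
qed

text \<open>
  In a 4-cycle the first and third edge have the same total sum as the second and fourth, so the
  Sidon property makes two consecutive edges equal.
\<close>

lemma no_4_cycle:
  assumes "E a b" "E b c" "E c d" "E d a" shows "a = c \<or> b = d"
proof -
  have "((a + b) mod m + (c + d) mod m) mod m = ((b + c) mod m + (d + a) mod m) mod m"
    by (simp add: mod_add_eq add_ac)
  then have "(a + b) mod m = (b + c) mod m \<or> (a + b) mod m = (d + a) mod m"
    using assms by (intro sidon[where r = "(c + d) mod m"]) (simp_all add: adj)
  then have "(b + a) mod m = (b + c) mod m \<or> (a + b) mod m = (a + d) mod m"
    by (simp add: add.commute)
  moreover have "a \<in> {0..<0 + m} \<and> c \<in> {0..<0 + m} \<or> a \<in> {m..<m + m} \<and> c \<in> {m..<m + m}"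
    "b \<in> {0..<0 + m} \<and> d \<in> {0..<0 + m} \<or> b \<in> {m..<m + m} \<and> d \<in> {m..<m + m}"
    using assms by (auto simp: adj)
  ultimately show ?thesis using cong_add_imp_eq by metis
qed

lemma girth: "girth G = enat 6"
proof (rule antisym)
  \<comment> \<open>Consecutive vertices have sums 0, 1, 4, 0, 1, 4 modulo \<open>m\<close>.\<close>
  define p where "p = [(0, m), (m, 1), (1, m + 3), (m + 3, m - 3), (m - 3, m + 4), (m + 4, 0)]"
  have "set p \<subseteq> parcs G"
    using m S(1,3) by (auto simp: p_def adj mod_if)
  then have "pre_digraph.cycle (with_proj G) p"
    using m by (auto simp: cycle_with_proj p_def verts)
  from girth_le[OF this] show "girth G \<le> enat 6" by (simp add: p_def eval_nat_numeral)
  show "enat 6 \<le> girth G"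
    unfolding girth_def
  proof (intro INF_greatest, rule ccontr)
    fix p assume "p \<in> {p. pre_digraph.cycle (with_proj G) p \<and> 3 \<le> length p}"
      and "\<not> enat 6 \<le> enat (length p)"
    then have "pre_digraph.cycle (with_proj G) p" "3 \<le> length p" "length p < 6" by auto
    then have len: "length p = 3 \<or> length p = 4 \<or> length p = 5" by linarith
    obtain u where u: "set p \<subseteq> parcs G" "pcas u p u" "distinct (tl (pawalk_verts u p))"
      using \<open>pre_digraph.cycle (with_proj G) p\<close> by (auto simp: cycle_with_proj)
    \<comment> \<open>The graph is bipartite, which rules out the odd lengths.\<close>
    have flip: "(b < m) = (\<not> a < m)" if "E a b" for a b using that by (auto simp: adj)
    from len show False
    proof (elim disjE)
      assume "length p = 3"
      then obtain a b c d e f where "p = [(a, b), (c, d), (e, f)]"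
        by (auto simp: numeral_eq_Suc length_Suc_conv)
      then have "E a c" "E c e" "E e a" using u by auto
      then show False using flip by blast
    next
      assume "length p = 4"
      then obtain a b c d e f g h where "p = [(a, b), (c, d), (e, f), (g, h)]"
        by (auto simp: numeral_eq_Suc length_Suc_conv)
      then have "E a c" "E c e" "E e g" "E g a" "a \<noteq> e" "c \<noteq> g" using u by auto
      then show False using no_4_cycle by blast
    next
      assume "length p = 5"
      then obtain a b c d e f g h i j where "p = [(a, b), (c, d), (e, f), (g, h), (i, j)]"
        by (auto simp: numeral_eq_Suc length_Suc_conv)
      then have "E a c" "E c e" "E e g" "E g i" "E i a" using u by auto
      then show False using flip by blast
    qed
  qed
qed

lemma connected: "connected (with_proj G)"
proof -
  interpret pair_graph G by (rule pair_graph)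
  have zero: "0 \<rightarrow>\<^sup>*\<^bsub>G\<^esub> i" if "i < m" for i
    using that
  proof (induction i)
    case 0 then show ?case by (simp add: verts)
  next
    case (Suc i)
    \<comment> \<open>The vertex of the second class that has sum 0 with \<open>i\<close> has sum 1 with \<open>i + 1\<close>.\<close>
    define j where "j = (if i = 0 then m else 2 * m - i)"
    have "E i j" "E j (Suc i)"
      using Suc.prems S(3) m by (auto simp: adj j_def mod_if)
    then show ?case using Suc by (meson Suc_lessD reachable_adj_trans)
  qed
  have all: "0 \<rightarrow>\<^sup>*\<^bsub>G\<^esub> a" if "a \<in> pverts G" for a
  proof (cases "a < m")
    case False
    define i where "i = (if a = m then 0 else 2 * m - a)"
    have "i < m" "E i a" using False that S(3) m by (auto simp: verts i_def adj)
    then show ?thesis using zero reachable_adj_trans by blast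
  qed (rule zero)
  have "u \<rightarrow>\<^sup>*\<^bsub>G\<^esub> v" if "u \<in> pverts G" "v \<in> pverts G" for u v
    using all[OF that(1)] all[OF that(2)] symmetric_reachable[OF sym_arcs] reachable_trans by blast
  then show ?thesis
    using m by (intro connectedI) (auto simp: verts lessThan_empty_iff reachable_mk_symmetric_eq[OF sym_arcs])
qed

lemma order_in_spectrum: "2 * m \<in> kg_spectrum 5 6"
proof -
  have "regular 5 G" unfolding regular_def out_degree_with_proj using degree by blast
  then have "kg_graph 5 6 G" unfolding kg_graph_def using pair_graph girth by blast
  moreover have "card (pverts G) = 2 * m" by (simp add: verts)
  ultimately show ?thesis unfolding kg_spectrum_def using connected by blast
qed

end

lemma order_42: "42 \<in> kg_spectrum 5 6"
proof -
  have diff: "\<forall>p \<in> {0, 1, 4, 14, 16 :: nat}. \<forall>q \<in> {0, 1, 4, 14, 16}. \<forall>r \<in> {0, 1, 4, 14, 16}. \<forall>t \<in> {0, 1, 4, 14, 16}.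
      (p + r) mod 21 = (q + t) mod 21 \<longrightarrow> p = q \<or> p = t"
    by simp
  interpret sum_graph_sidon 21 "{0, 1, 4, 14, 16}"
  proof
    fix p q r t :: nat
    assume S: "p \<in> {0, 1, 4, 14, 16}" "q \<in> {0, 1, 4, 14, 16}" "r \<in> {0, 1, 4, 14, 16}" "t \<in> {0, 1, 4, 14, 16}"
      and "(p + r) mod 21 = (q + t) mod 21"
    then show "p = q \<or> p = t" by (rule diff[rule_format])
  qed auto
  show ?thesis using order_in_spectrum by simp
qed

text \<open>
  All sums of two marks are at most 22, so modulo \<open>m \<ge> 23\<close> they coincide only if they are equal.
\<close>

lemma large_even_order:
  assumes "23 \<le> m" shows "2 * m \<in> kg_spectrum 5 6"
proof -
  have ruler: "\<forall>p \<in> {0, 1, 4, 9, 11 :: nat}. \<forall>q \<in> {0, 1, 4, 9, 11}. \<forall>r \<in> {0, 1, 4, 9, 11}. \<forall>t \<in> {0, 1, 4, 9, 11}.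
      p + r = q + t \<longrightarrow> p = q \<or> p = t"
    by simp
  have small: "p < 12" if "p \<in> {0, 1, 4, 9, 11 :: nat}" for p using that by auto
  interpret sum_graph_sidon m "{0, 1, 4, 9, 11}"
  proof
    fix p q r t :: nat
    assume S: "p \<in> {0, 1, 4, 9, 11}" "q \<in> {0, 1, 4, 9, 11}" "r \<in> {0, 1, 4, 9, 11}" "t \<in> {0, 1, 4, 9, 11}"
      and "(p + r) mod m = (q + t) mod m"
    then have "p + r = q + t"
      using small[OF S(1)] small[OF S(2)] small[OF S(3)] small[OF S(4)] assms by simp
    with S show "p = q \<or> p = t" by (rule ruler[rule_format])
  qed (use assms in auto)
  show ?thesis by (rule order_in_spectrum)
qed

section \<open>The spectrum\<close>

lemma spectrum_5_6: "kg_spectrum 5 6 = {42} \<union> {n. even n \<and> 46 \<le> n}"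
proof (intro equalityI subsetI)
  fix n assume n: "n \<in> kg_spectrum 5 6"
  then have "n \<noteq> 44" using no_order_44 unfolding kg_spectrum_def by blast
  moreover have "even n" "42 \<le> n" using n by (rule spectrum_even_ge_42)+
  ultimately have "n = 42 \<or> even n \<and> 46 \<le> n" by presburger
  then show "n \<in> {42} \<union> {n. even n \<and> 46 \<le> n}" by simp
next
  fix n :: nat assume "n \<in> {42} \<union> {n. even n \<and> 46 \<le> n}"
  then consider "n = 42" | m where "n = 2 * m" "23 \<le> m" by (auto elim!: evenE)
  then show "n \<in> kg_spectrum 5 6" using order_42 large_even_order by cases auto
qed

theorem mainTheorem15:
  shows "kg_spectrum 5 6 = {42} \<union> {n. even n \<and> 46 \<le> n}
    \<and> \<not> (\<exists>G :: 'a pair_pre_digraph. kg_graph 5 6 G \<and> card (pverts G) = 44)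
    \<and> kg_N 5 6 = 46"
proof (intro conjI)
  show "kg_spectrum 5 6 = {42} \<union> {n. even n \<and> 46 \<le> n}" by (rule spectrum_5_6)
  show "\<not> (\<exists>G :: 'a pair_pre_digraph. kg_graph 5 6 G \<and> card (pverts G) = 44)"
    using no_order_44 by blast
  show "kg_N 5 6 = 46"
    unfolding kg_N_def spectrum_5_6
  proof (rule Least_equality)
    fix N :: nat
    assume N: "N \<in> {42} \<union> {n. even n \<and> 46 \<le> n} \<and>
      (\<forall>n\<ge>N. even n \<longrightarrow> n \<in> {42} \<union> {n. even n \<and> 46 \<le> n})"
    \<comment> \<open>The even number 44 is missing, so \<open>N\<close> cannot be 42.\<close>
    have "\<not> N \<le> 44"
    proof
      assume "N \<le> 44"
      then have "44 \<in> {42} \<union> {n :: nat. even n \<and> 46 \<le> n}" using N[THEN conjunct2, rule_format, of 44] by simp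
      then show False by simp
    qed
    moreover have "even N" using N[THEN conjunct1] by auto
    ultimately show "46 \<le> N" by presburger
  qed simp
qed

end
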